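(* Let $n\ge 1$, let $m_1,\dots,m_n>0$ be fixed constants, and consider on $M=\{(x_1,\dots,x_n)\in\mathbb{R}^n: x_1<\dots<x_n\}$ the conservative peakon system $$\dot x_j=2\sum_{\substack{1\le k\le n\\k\ne j}} m_jm_ke^{-|x_j-x_k|}+4\sum_{1\le i<j<k\le n} m_im_ke^{-|x_i-x_k|},\qquad 1\le j\le n,$$ which is the Hamiltonian vector field of $h=\sum_{i,k}m_im_ke^{-|x_i-x_k|}$ with respect to the Poisson bracket $\pi$ determined by $\{x_i,x_k\}=\operatorname{sgn}(x_i-x_k)$. Then this system is Liouville integrable on the Poisson manifold $(M,\pi)$.
   Context: Liouville integrability of a Hamiltonian system on an $n$-dimensional Poisson manifold $(M,\pi)$ means: there are $s$ constants of motion which pairwise Poisson commute and are functionally independent (their differentials have nonzero wedge product on a dense subset of $M$), with $\tfrac12\operatorname{rank}(\pi)+s=n$. Here $\operatorname{rank}(\pi)=2K$ where $n=2K$ or $n=2K+1$. *)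

theory Defs
  imports "HOL-Analysis.Analysis"
begin

text \<open>Coordinates on R^n are indexed by a finite linearly ordered type 'n, with n = CARD('n).\<close>

definition pd :: "(real^('n::finite) \<Rightarrow> real) \<Rightarrow> 'n \<Rightarrow> real^'n \<Rightarrow> real" where
  "pd f i x = frechet_derivative f (at x) (axis i 1)"

definition grad :: "(real^('n::finite) \<Rightarrow> real) \<Rightarrow> real^'n \<Rightarrow> real^'n" where
  "grad f x = (\<chi> i. pd f i x)"

fun iter_pd :: "('n::finite) list \<Rightarrow> (real^'n \<Rightarrow> real) \<Rightarrow> (real^'n \<Rightarrow> real)" where
  "iter_pd [] f = f"
| "iter_pd (i # is) f = pd (iter_pd is f) i"

definition smooth_on :: "(real^('n::finite)) set \<Rightarrow> (real^'n \<Rightarrow> real) \<Rightarrow> bool" where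
  "smooth_on U f \<longleftrightarrow> (\<forall>is. iter_pd is f differentiable_on U)"

definition pbracket :: "(real^('n::finite) \<Rightarrow> real^'n^'n) \<Rightarrow> (real^'n \<Rightarrow> real) \<Rightarrow> (real^'n \<Rightarrow> real) \<Rightarrow> real^'n \<Rightarrow> real" where
  "pbracket P f g x = (\<Sum>i\<in>UNIV. \<Sum>k\<in>UNIV. pd f i x * (P x $ i $ k) * pd g k x)"

definition ham_field :: "(real^('n::finite) \<Rightarrow> real^'n^'n) \<Rightarrow> (real^'n \<Rightarrow> real) \<Rightarrow> real^'n \<Rightarrow> real^'n" where
  "ham_field P h x = (\<chi> j. \<Sum>k\<in>UNIV. (P x $ j $ k) * pd h k x)"

definition poisson_rank :: "(real^('n::finite)) set \<Rightarrow> (real^'n \<Rightarrow> real^'n^'n) \<Rightarrow> nat" where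
  "poisson_rank M P = Max ((\<lambda>x. rank (P x)) ` M)"

definition indep_at :: "nat \<Rightarrow> (nat \<Rightarrow> real^('n::finite) \<Rightarrow> real) \<Rightarrow> real^'n \<Rightarrow> bool" where
  "indep_at s F x \<longleftrightarrow> (\<forall>c. (\<Sum>i<s. c i *\<^sub>R grad (F i) x) = 0 \<longrightarrow> (\<forall>i<s. c i = 0))"

definition liouville_integrable ::
  "(real^('n::finite)) set \<Rightarrow> (real^'n \<Rightarrow> real^'n^'n) \<Rightarrow> (real^'n \<Rightarrow> real) \<Rightarrow> bool" where
  "liouville_integrable M P h \<longleftrightarrow>
     (\<exists>s F. (\<forall>i<s. smooth_on M (F i))
        \<and> (\<forall>i<s. \<forall>x\<in>M. pbracket P (F i) h x = 0)
        \<and> (\<forall>i<s. \<forall>j<s. \<forall>x\<in>M. pbracket P (F i) (F j) x = 0)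
        \<and> M \<subseteq> closure {x\<in>M. indep_at s F x}
        \<and> poisson_rank M P div 2 + s = CARD('n))"

definition peakon_domain :: "(real^'n::{finite,linorder}) set" where
  "peakon_domain = {x. \<forall>i j. i < j \<longrightarrow> x $ i < x $ j}"

definition peakon_poisson :: "real^('n::finite) \<Rightarrow> real^'n^'n" where
  "peakon_poisson x = (\<chi> i k. sgn (x $ i - x $ k))"

definition peakon_ham :: "('n::finite \<Rightarrow> real) \<Rightarrow> real^'n \<Rightarrow> real" where
  "peakon_ham m x = (\<Sum>i\<in>UNIV. \<Sum>k\<in>UNIV. m i * m k * exp (- \<bar>x $ i - x $ k\<bar>))"

definition peakon_field :: "('n::{finite,linorder} \<Rightarrow> real) \<Rightarrow> (real, 'n) vec \<Rightarrow> (real, 'n) vec" where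
  "peakon_field m x = (\<chi> j.
      2 * (\<Sum>k\<in>{k. k \<noteq> j}. m j * m k * exp (- \<bar>x $ j - x $ k\<bar>))
    + 4 * (\<Sum>i\<in>{i. i < j}. \<Sum>k\<in>{k. j < k}. m i * m k * exp (- \<bar>x $ i - x $ k\<bar>)))"

end

theory Submission
  imports Defs "HOL-Complex_Analysis.Conformal_Mappings"
begin

text \<open>
  The coefficients of the product of the Lax transition matrices, taken at spectral parameters \<open>z\<close>
  and \<open>w\<close>, have Poisson brackets that close under adding one site; by induction the values of
  one coefficient at all spectral parameters commute, and its value at \<open>0\<close> is essentially the
  Hamiltonian. The values at \<open>1, ..., n div 2\<close>, together with the exponential of the alternating
  sum of the coordinates when \<open>n\<close> is odd, are the required integrals. All of them are sums of
  exponentials of linear forms, so by analytic continuation along lines a Jacobian minor that is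
  nonzero at a single point of \<open>\<real>\<^sup>n\<close> is nonzero on a dense set. Such a point is found in the limit where
  the peakons form far apart pairs.
\<close>

section \<open>Exponential sums\<close>

lemma pd_eqI: "(f has_derivative D) (at x) \<Longrightarrow> pd f i x = D (axis i 1)"
  unfolding pd_def using frechet_derivative_at by metis

text \<open>Finite real combinations of exponentials of linear forms. The class is stable under
  products, partial derivatives and determinants, and its members are smooth on the whole space and
  extend to entire functions along every line.\<close>

inductive expsum :: "(real^('n::finite) \<Rightarrow> real) \<Rightarrow> bool" where
  exp: "expsum (\<lambda>x. c * exp (a \<bullet> x))"
| add: "expsum f \<Longrightarrow> expsum g \<Longrightarrow> expsum (\<lambda>x. f x + g x)"

lemma expsum_const [intro, simp]: "expsum (\<lambda>x. c)"
  using expsum.exp[of c 0] by simp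

lemma expsum_exp_coord [intro, simp]:
  "expsum (\<lambda>x. exp (x $ i))" "expsum (\<lambda>x. exp (- x $ i))"
  using expsum.exp[of 1 "axis i 1"] expsum.exp[of 1 "- axis i 1"] by (simp_all add: inner_axis')

lemma expsum_mult:
  assumes "expsum f" "expsum g" shows "expsum (\<lambda>x. f x * g x)"
proof -
  have *: "expsum (\<lambda>x. c * exp (a \<bullet> x) * g x)" for c a
    using assms(2)
  proof induction
    case (exp d b)
    then show ?case
      using expsum.exp[of "c * d" "a + b"] by (simp add: inner_add_left exp_add ac_simps)
  next
    case (add f g)
    then show ?case
      using expsum.add[of "\<lambda>x. c * exp (a \<bullet> x) * f x" "\<lambda>x. c * exp (a \<bullet> x) * g x"]
      by (simp add: algebra_simps)
  qed
  show ?thesis using assms(1)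
  proof induction
    case (exp c a)
    then show ?case by (rule *)
  next
    case (add f1 f2)
    then show ?case
      using expsum.add[of "\<lambda>x. f1 x * g x" "\<lambda>x. f2 x * g x"] by (simp add: algebra_simps)
  qed
qed

lemma expsum_uminus: "expsum f \<Longrightarrow> expsum (\<lambda>x. - f x)"
  using expsum_mult[OF expsum_const[of "- 1"]] by simp

lemma expsum_diff: "expsum f \<Longrightarrow> expsum g \<Longrightarrow> expsum (\<lambda>x. f x - g x)"
  using expsum.add[OF _ expsum_uminus] by simp

lemma expsum_sum: "(\<And>i. i \<in> I \<Longrightarrow> expsum (f i)) \<Longrightarrow> expsum (\<lambda>x. \<Sum>i\<in>I. f i x)"
  by (induction I rule: infinite_finite_induct) (auto intro: expsum.add)

lemma expsum_prod: "(\<And>i. i \<in> I \<Longrightarrow> expsum (f i)) \<Longrightarrow> expsum (\<lambda>x. \<Prod>i\<in>I. f i x)"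
  by (induction I rule: infinite_finite_induct) (auto intro: expsum_mult)

lemma expsum_det:
  assumes "\<And>i j. expsum (\<lambda>x. A x $ i $ j)" shows "expsum (\<lambda>x. det (A x))"
  unfolding det_def by (intro expsum_sum expsum_mult expsum_prod assms expsum_const)

section \<open>Differential calculus of exponential sums\<close>

lemma has_derivative_expsum_term:
  "((\<lambda>x. c * exp (a \<bullet> x)) has_derivative (\<lambda>v. c * exp (a \<bullet> x) * (a \<bullet> v))) (at x)"
  by (auto intro!: derivative_eq_intros)

lemma pd_expsum_term: "pd (\<lambda>x. c * exp (a \<bullet> x)) i x = c * exp (a \<bullet> x) * a $ i"
  by (simp add: pd_eqI[OF has_derivative_expsum_term] inner_axis)

lemma expsum_differentiable: "expsum f \<Longrightarrow> f differentiable (at x)"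
proof (induction rule: expsum.induct)
  case (exp c a)
  then show ?case using has_derivative_expsum_term by (rule differentiableI)
qed auto

lemma expsum_has_derivative:
  "expsum f \<Longrightarrow> (f has_derivative frechet_derivative f (at x)) (at x)"
  using expsum_differentiable frechet_derivative_works by blast

lemma pd_const [simp]: "pd (\<lambda>x. c) i x = 0"
  by (rule pd_eqI[where D = "\<lambda>_. 0", simplified]) simp

lemma pd_add:
  assumes "expsum f" "expsum g"
  shows "pd (\<lambda>x. f x + g x) i x = pd f i x + pd g i x"
  unfolding pd_eqI[OF has_derivative_add[OF assms[THEN expsum_has_derivative]]]
  by (simp add: pd_def)

lemma pd_diff:
  assumes "expsum f" "expsum g"
  shows "pd (\<lambda>x. f x - g x) i x = pd f i x - pd g i x"
  unfolding pd_eqI[OF has_derivative_diff[OF assms[THEN expsum_has_derivative]]]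
  by (simp add: pd_def)

lemma pd_sum:
  "(\<And>j. j \<in> J \<Longrightarrow> expsum (f j)) \<Longrightarrow> pd (\<lambda>x. \<Sum>j\<in>J. f j x) i x = (\<Sum>j\<in>J. pd (f j) i x)"
  by (induction J rule: infinite_finite_induct) (auto simp: pd_add expsum_sum)

lemma pd_mult:
  assumes "expsum f" "expsum g"
  shows "pd (\<lambda>x. f x * g x) i x = f x * pd g i x + pd f i x * g x"
  unfolding pd_eqI[OF has_derivative_mult[OF assms[THEN expsum_has_derivative]]]
  by (simp add: pd_def)

lemma pd_exp_coord:
  "pd (\<lambda>x. exp (x $ j)) i x = (if i = j then exp (x $ j) else 0)"
  "pd (\<lambda>x. exp (- x $ j)) i x = (if i = j then - exp (- x $ j) else 0)"
  using pd_expsum_term[of 1 "axis j 1" i x] pd_expsum_term[of 1 "- axis j 1" i x]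
  by (simp_all add: inner_axis') (simp_all add: axis_def)

lemma expsum_pd: "expsum f \<Longrightarrow> expsum (pd f i)"
proof (induction rule: expsum.induct)
  case (exp c a)
  have "pd (\<lambda>x. c * exp (a \<bullet> x)) i = (\<lambda>x. (c * a $ i) * exp (a \<bullet> x))"
    by (auto simp: pd_expsum_term fun_eq_iff)
  then show ?case by (simp add: expsum.exp)
next
  case (add f g)
  then have "pd (\<lambda>x. f x + g x) i = (\<lambda>x. pd f i x + pd g i x)"
    by (auto simp: pd_add)
  with add show ?case by (simp add: expsum.add)
qed

text \<open>Serves \<open>peakon_ham\<close>, whose absolute values make it an exponential sum only
  on the open domain; a derivative at a point sees only nearby values.\<close>

lemma pd_transform_open:
  assumes "open U" "x \<in> U" "\<And>y. y \<in> U \<Longrightarrow> f y = g y" "expsum g"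
  shows "pd f i x = pd g i x"
proof -
  have "(f has_derivative frechet_derivative g (at x)) (at x)"
    by (rule has_derivative_transform_within_open[OF expsum_has_derivative[OF assms(4)] assms(1,2)])
      (simp add: assms(3))
  then show ?thesis by (simp add: pd_eqI) (simp add: pd_def)
qed

lemma expsum_smooth_on: "expsum f \<Longrightarrow> smooth_on U f"
proof -
  assume f: "expsum f"
  have "expsum (iter_pd is f)" for "is"
    using f by (induction "is") (auto intro: expsum_pd)
  then show ?thesis
    unfolding smooth_on_def
    by (meson differentiable_at_imp_differentiable_on expsum_differentiable)
qed

section \<open>Analytic continuation along lines\<close>

lemma expsum_line_holomorphic:
  assumes "expsum f"
  shows "\<exists>F. F holomorphic_on UNIV \<and>
    (\<forall>t. F (complex_of_real t) = of_real (f (x + t *\<^sub>R v)))"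
  using assms
proof induction
  case (exp c a)
  show ?case
    by (rule exI[of _ "\<lambda>z. of_real (c * exp (a \<bullet> x)) * exp (of_real (a \<bullet> v) * z)"])
      (auto intro!: holomorphic_intros
         simp: inner_add_right exp_add mult.commute simp flip: exp_of_real)
next
  case (add f g)
  then obtain F G where "F holomorphic_on UNIV" "G holomorphic_on UNIV"
    "\<forall>t. F (complex_of_real t) = of_real (f (x + t *\<^sub>R v))"
    "\<forall>t. G (complex_of_real t) = of_real (g (x + t *\<^sub>R v))" by blast
  then show ?case
    by (intro exI[of _ "\<lambda>z. F z + G z"]) (auto intro!: holomorphic_intros)
qed

text \<open>Join \<open>x\<close> to \<open>x0\<close> by a line. If \<open>f\<close> vanished on
  \<open>U\<close>, its entire extension along the line would vanish on a real interval accumulating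
  at 0, hence everywhere by the identity theorem, in particular at parameter 1, which is
  \<open>x0\<close>.\<close>

lemma expsum_nonzero_dense:
  fixes f :: "real^'n::finite \<Rightarrow> real"
  assumes f: "expsum f" and x0: "f x0 \<noteq> 0" and U: "open U" "x \<in> U"
  shows "\<exists>y\<in>U. f y \<noteq> 0"
proof (rule ccontr)
  assume neg: "\<not> ?thesis"
  obtain F where hol: "F holomorphic_on UNIV"
    and F: "\<And>t. F (complex_of_real t) = of_real (f (x + t *\<^sub>R (x0 - x)))"
    using expsum_line_holomorphic[OF f] by blast
  have "((\<lambda>t. x + t *\<^sub>R (x0 - x)) \<longlongrightarrow> x + 0 *\<^sub>R (x0 - x)) (at_right 0)"
    by (intro tendsto_intros)
  then have "eventually (\<lambda>t. x + t *\<^sub>R (x0 - x) \<in> U) (at_right 0)"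
    using U topological_tendstoD by fastforce
  then obtain d where d: "d > 0" "\<And>t. 0 < t \<Longrightarrow> t < d \<Longrightarrow> x + t *\<^sub>R (x0 - x) \<in> U"
    unfolding eventually_at_right_field by blast
  let ?S = "complex_of_real ` {0<..<d}"
  have "(0::complex) islimpt ?S"
    unfolding islimpt_approachable
  proof (intro allI impI)
    fix e :: real assume "e > 0"
    then have "min (e/2) (d/2) \<in> {0<..<d}" "min (e/2) (d/2) < e" using d(1) by auto
    then show "\<exists>x'\<in>?S. x' \<noteq> 0 \<and> dist x' 0 < e"
      by (intro bexI[of _ "complex_of_real (min (e/2) (d/2))"] imageI)
         (auto simp: dist_norm simp del: of_real_divide min_less_iff_disj)
  qed
  moreover have "F z = 0" if "z \<in> ?S" for z
    using that d neg by (auto simp: F)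
  ultimately have "F 1 = 0"
    using analytic_continuation[OF hol open_UNIV connected_UNIV, of ?S 0 1] by blast
  then show False using F[of 1] x0 by simp
qed

section \<open>Poisson brackets of the transition coefficients\<close>

text \<open>The abstract index type is enumerated increasingly from 0, so that one can induct on the
  number of peakons and speak of parity.\<close>

definition site :: "nat \<Rightarrow> 'n::{finite,linorder}" where
  "site k = sorted_list_of_set UNIV ! k"

lemma site_strict_mono: "i < j \<Longrightarrow> j < CARD('n) \<Longrightarrow> site i < (site j :: 'n::{finite,linorder})"
  unfolding site_def by (rule sorted_wrt_nth_less[of "(<)"]) auto

lemma bij_betw_site: "bij_betw site {..<CARD('n)} (UNIV :: 'n::{finite,linorder} set)"
  unfolding site_def by (rule bij_betw_nth) auto

lemma sum_site: "(\<Sum>i\<in>(UNIV :: 'n::{finite,linorder} set). f i) = (\<Sum>k<CARD('n). f (site k))"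
  by (rule sum.reindex_bij_betw[OF bij_betw_site, symmetric])

lemma site_eq_iff:
  assumes "i < CARD('n)" "j < CARD('n)"
  shows "(site i :: 'n::{finite,linorder}) = site j \<longleftrightarrow> i = j"
  using bij_betw_site[where 'n='n] assms by (auto simp: bij_betw_def inj_on_def)

lemma site_less_iff:
  assumes "i < CARD('n)" "j < CARD('n)"
  shows "(site i :: 'n::{finite,linorder}) < site j \<longleftrightarrow> i < j"
  using site_strict_mono[where 'n='n] assms by (metis linorder_neqE_nat order.asym order.irrefl)

lemma ex_site: "\<exists>k<CARD('n). i = (site k :: 'n::{finite,linorder})"
  using bij_betw_site[where 'n='n] by (force simp: bij_betw_def)

text \<open>On the domain the positions are ordered like their indices, so the Poisson matrix is
  constant there.\<close>

lemma peakon_poisson_site: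
  fixes x :: "real^'n::{finite,linorder}"
  assumes "x \<in> peakon_domain" "i < CARD('n)" "j < CARD('n)"
  shows "peakon_poisson x $ site i $ site j = sgn (real i - real j)"
proof -
  have mono: "a < b \<Longrightarrow> b < CARD('n) \<Longrightarrow> x $ site a < x $ site b" for a b
    using assms(1) site_strict_mono[where 'n='n] by (auto simp: peakon_domain_def)
  show ?thesis
    using assms mono[of i j] mono[of j i]
    by (cases i j rule: linorder_cases) (auto simp: peakon_poisson_def)
qed

lemma peakon_poisson_antisym: "peakon_poisson x $ j $ i = - peakon_poisson x $ i $ j"
  by (simp add: peakon_poisson_def sgn_if)

section \<open>The bracket as an antisymmetric biderivation\<close>

lemma pbracket_add_left:
  "expsum f \<Longrightarrow> expsum g \<Longrightarrow>
   pbracket P (\<lambda>x. f x + g x) h x = pbracket P f h x + pbracket P g h x"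
  by (simp add: pbracket_def pd_add algebra_simps sum.distrib)

lemma pbracket_add_right:
  "expsum f \<Longrightarrow> expsum g \<Longrightarrow>
   pbracket P h (\<lambda>x. f x + g x) x = pbracket P h f x + pbracket P h g x"
  by (simp add: pbracket_def pd_add algebra_simps sum.distrib)

lemma pbracket_diff_left:
  "expsum f \<Longrightarrow> expsum g \<Longrightarrow>
   pbracket P (\<lambda>x. f x - g x) h x = pbracket P f h x - pbracket P g h x"
  by (simp add: pbracket_def pd_diff algebra_simps sum_subtractf)

lemma pbracket_diff_right:
  "expsum f \<Longrightarrow> expsum g \<Longrightarrow>
   pbracket P h (\<lambda>x. f x - g x) x = pbracket P h f x - pbracket P h g x"
  by (simp add: pbracket_def pd_diff algebra_simps sum_subtractf)

lemma pbracket_mult_left: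
  "expsum f \<Longrightarrow> expsum g \<Longrightarrow>
   pbracket P (\<lambda>x. f x * g x) h x = f x * pbracket P g h x + g x * pbracket P f h x"
  by (simp add: pbracket_def pd_mult algebra_simps sum.distrib sum_distrib_left)

lemma pbracket_mult_right:
  "expsum f \<Longrightarrow> expsum g \<Longrightarrow>
   pbracket P h (\<lambda>x. f x * g x) x = f x * pbracket P h g x + g x * pbracket P h f x"
  by (simp add: pbracket_def pd_mult algebra_simps sum.distrib sum_distrib_left)

lemma pbracket_const [simp]: "pbracket P (\<lambda>x. c) f x = 0" "pbracket P f (\<lambda>x. c) x = 0"
  by (simp_all add: pbracket_def)

lemma pbracket_antisym: "pbracket peakon_poisson g f x = - pbracket peakon_poisson f g x"
proof -
  have "pbracket peakon_poisson g f x =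
      (\<Sum>i\<in>UNIV. \<Sum>k\<in>UNIV. - (pd f k x * (peakon_poisson x $ k $ i) * pd g i x))"
    unfolding pbracket_def
    by (intro sum.cong refl) (metis (no_types, lifting) peakon_poisson_antisym
        mult.assoc mult.commute mult_minus_left)
  also have "\<dots> = - pbracket peakon_poisson f g x"
    unfolding pbracket_def by (subst sum.swap) (simp add: sum_negf)
  finally show ?thesis .
qed

lemma pbracket_exp_coord:
  "pbracket P (\<lambda>x. exp (x $ i)) f x = exp (x $ i) * (\<Sum>k\<in>UNIV. P x $ i $ k * pd f k x)" (is ?pos)
  "pbracket P (\<lambda>x. exp (- x $ i)) f x =
     - exp (- x $ i) * (\<Sum>k\<in>UNIV. P x $ i $ k * pd f k x)" (is ?neg)
proof -
  have "(\<Sum>k\<in>UNIV. pd (\<lambda>x. exp (x $ i)) j x * P x $ j $ k * pd f k x) =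
      (if j = i then exp (x $ i) * (\<Sum>k\<in>UNIV. P x $ i $ k * pd f k x) else 0)" for j
    by (simp add: pd_exp_coord sum_distrib_left mult.assoc)
  then show ?pos by (simp add: pbracket_def)
  have "(\<Sum>k\<in>UNIV. pd (\<lambda>x. exp (- x $ i)) j x * P x $ j $ k * pd f k x) =
      (if j = i then - exp (- x $ i) * (\<Sum>k\<in>UNIV. P x $ i $ k * pd f k x) else 0)" for j
    by (simp add: pd_exp_coord sum_distrib_left mult.assoc)
  then show ?neg by (simp add: pbracket_def)
qed

text \<open>
  With \<open>g = m e\<^sup>-\<^sup>x\<close> and \<open>h = m e\<^sup>x\<close> at each site, \<open>(peak_q, 1 - z peak_r)\<close> is the second
  column of the product of the Lax transition matrices with rows \<open>(1, h)\<close> and \<open>(- z g, 1)\<close>.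
  Dividing by \<open>z\<close> keeps the value \<open>z = 0\<close> meaningful, where \<open>peak_r\<close> is the Hamiltonian
  up to affine normalisation.
\<close>

fun peak_r :: "('n::{finite,linorder} \<Rightarrow> real) \<Rightarrow> real \<Rightarrow> nat \<Rightarrow> (real, 'n) vec \<Rightarrow> real"
and peak_q :: "('n::{finite,linorder} \<Rightarrow> real) \<Rightarrow> real \<Rightarrow> nat \<Rightarrow> (real, 'n) vec \<Rightarrow> real" where
  "peak_r m z 0 = (\<lambda>x. 0)"
| "peak_r m z (Suc k) =
     (\<lambda>x. peak_r m z k x + m (site k) * (exp (- x $ site k) * peak_q m z k x))"
| "peak_q m z 0 = (\<lambda>x. 0)"
| "peak_q m z (Suc k) =
     (\<lambda>x. peak_q m z k x + m (site k) * (exp (x $ site k) * (1 - z * peak_r m z k x)))"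

lemma expsum_peak [intro, simp]: "expsum (peak_r m z k)" "expsum (peak_q m z k)"
  by (induction k) (auto intro!: expsum.add expsum_diff expsum_mult)

lemma pd_peak_Suc:
  fixes m :: "'n::{finite,linorder} \<Rightarrow> real"
  shows "pd (peak_r m z (Suc k)) i x = pd (peak_r m z k) i x
      + m (site k) * exp (- x $ site k) * (pd (peak_q m z k) i x
      - (if i = site k then peak_q m z k x else 0))"
    and "pd (peak_q m z (Suc k)) i x = pd (peak_q m z k) i x
      + m (site k) * exp (x $ site k) * (- z * pd (peak_r m z k) i x
      + (if i = site k then 1 - z * peak_r m z k x else 0))"
  by (simp_all add: pd_add pd_diff pd_mult expsum_mult expsum_diff expsum.add pd_exp_coord)
     (simp_all add: algebra_simps)

lemma pd_peak_later_site:
  fixes m :: "'n::{finite,linorder} \<Rightarrow> real"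
  assumes "k \<le> j" "j < CARD('n)"
  shows "pd (peak_r m z k) (site j) x = 0 \<and> pd (peak_q m z k) (site j) x = 0"
  using assms
proof (induction k)
  case (Suc k)
  then have "site j \<noteq> (site k :: 'n)" by (simp add: site_eq_iff)
  with Suc show ?case by (simp del: peak_r.simps peak_q.simps add: pd_peak_Suc)
qed simp_all

text \<open>Translating all coordinates by \<open>c\<close> leaves \<open>peak_r\<close> invariant
  and multiplies \<open>peak_q\<close> by \<open>exp c\<close>; these are the Euler identities for
  degrees 0 and 1.\<close>

lemma euler_peak:
  "(\<Sum>i\<in>UNIV. pd (peak_r m z k) i x) = 0 \<and> (\<Sum>i\<in>UNIV. pd (peak_q m z k) i x) = peak_q m z k x"
proof (induction k)
  case (Suc k)
  then show ?case
    by (simp only: pd_peak_Suc sum.distrib sum_subtractf flip: sum_distrib_left) simp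
qed simp_all

text \<open>
  The nonlocal bracket of \<open>x\<^sub>k\<close> with a function of the earlier coordinates is the total derivative,
  so it only sees the degree of homogeneity under translations.
\<close>

lemma sum_poisson_row:
  fixes x :: "real^'n::{finite,linorder}"
  assumes x: "x \<in> peakon_domain" and k: "k < CARD('n)"
    and "\<And>j. k \<le> j \<Longrightarrow> j < CARD('n) \<Longrightarrow> v (site j) = 0"
  shows "(\<Sum>j\<in>UNIV. peakon_poisson x $ site k $ j * v j) = (\<Sum>j\<in>UNIV. v j)"
  unfolding sum_site
proof (intro sum.cong refl)
  fix j assume "j \<in> {..<CARD('n)}"
  then show "peakon_poisson x $ site k $ site j * v (site j) = v (site j)"
    using assms by (cases "k \<le> j") (auto simp: peakon_poisson_site)
qed

text \<open>The row sum of the Poisson matrix turns the bracket into a total derivative, and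
  \<open>euler_peak\<close> evaluates it: degree 0 for \<open>peak_r\<close>, degree 1 for
  \<open>peak_q\<close>.\<close>

lemma pbracket_exp_peak:
  fixes x :: "real^'n::{finite,linorder}"
  assumes "x \<in> peakon_domain" "k < CARD('n)"
  shows "pbracket peakon_poisson (\<lambda>x. exp (x $ site k)) (peak_r m z k) x = 0"
    "pbracket peakon_poisson (\<lambda>x. exp (- x $ site k)) (peak_r m z k) x = 0"
    "pbracket peakon_poisson (\<lambda>x. exp (x $ site k)) (peak_q m z k) x
      = exp (x $ site k) * peak_q m z k x"
    "pbracket peakon_poisson (\<lambda>x. exp (- x $ site k)) (peak_q m z k) x
      = - exp (- x $ site k) * peak_q m z k x"
  using sum_poisson_row[OF assms, of "\<lambda>j. pd (peak_r m z k) j x"]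
    sum_poisson_row[OF assms, of "\<lambda>j. pd (peak_q m z k) j x"]
  by (simp_all add: pbracket_exp_coord pd_peak_later_site euler_peak)

lemma pbracket_exp_exp:
  "pbracket peakon_poisson (\<lambda>x. exp (x $ i)) (\<lambda>x. exp (x $ i)) x = 0"
  "pbracket peakon_poisson (\<lambda>x. exp (x $ i)) (\<lambda>x. exp (- x $ i)) x = 0"
  "pbracket peakon_poisson (\<lambda>x. exp (- x $ i)) (\<lambda>x. exp (x $ i)) x = 0"
  "pbracket peakon_poisson (\<lambda>x. exp (- x $ i)) (\<lambda>x. exp (- x $ i)) x = 0"
  by (simp_all add: pbracket_exp_coord pd_exp_coord if_distrib[of "\<lambda>y. _ * y"]
      peakon_poisson_def cong: if_cong)

text \<open>These four brackets are the smallest family that reproduces itself when a site is added.\<close>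

lemma pbracket_peak:
  fixes x :: "real^'n::{finite,linorder}" and m :: "'n \<Rightarrow> real"
  assumes x: "x \<in> peakon_domain" and "z \<noteq> w" and "k \<le> CARD('n)"
  defines "W \<equiv> \<lambda>k. peak_q m z k x * (1 - w * peak_r m w k x) - (1 - z * peak_r m z k x) * peak_q m w k x"
  shows "pbracket peakon_poisson (peak_r m z k) (peak_r m w k) x = 0
    \<and> pbracket peakon_poisson (peak_q m z k) (peak_q m w k) x = 0
    \<and> (w - z) * pbracket peakon_poisson (peak_q m z k) (peak_r m w k) x = - W k
    \<and> (w - z) * pbracket peakon_poisson (peak_r m z k) (peak_q m w k) x = W k"
  using \<open>k \<le> CARD('n)\<close>
proof (induction k)
  case 0
  then show ?case by (simp add: W_def)
next
  case (Suc k)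
  then have k: "k < CARD('n)" by simp
  define r q R Q where "r = peak_r m z k x" "q = peak_q m z k x"
    "R = peak_r m w k x" "Q = peak_q m w k x"
  define a b where "a = pbracket peakon_poisson (peak_q m z k) (peak_r m w k) x"
    "b = pbracket peakon_poisson (peak_r m z k) (peak_q m w k) x"
  define g h where "g = exp (- x $ site k)" "h = exp (x $ site k)"
  note rev = pbracket_antisym[of "peak_r m z k" "\<lambda>x. exp (x $ site k)"]
    pbracket_antisym[of "peak_r m z k" "\<lambda>x. exp (- x $ site k)"]
    pbracket_antisym[of "peak_q m z k" "\<lambda>x. exp (x $ site k)"]
    pbracket_antisym[of "peak_q m z k" "\<lambda>x. exp (- x $ site k)"]
  have IH: "pbracket peakon_poisson (peak_r m z k) (peak_r m w k) x = 0"
    "pbracket peakon_poisson (peak_q m z k) (peak_q m w k) x = 0"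
    "(w - z) * a = - (q * (1 - w * R) - (1 - z * r) * Q)"
    "(w - z) * b = q * (1 - w * R) - (1 - z * r) * Q"
    using Suc by (simp_all add: W_def a_b_def r_q_R_Q_def)
  note expand = pbracket_add_left pbracket_add_right pbracket_diff_left pbracket_diff_right
    pbracket_mult_left pbracket_mult_right expsum_mult expsum_diff expsum.add
    pbracket_exp_peak[OF x k] pbracket_exp_exp rev
    IH(1,2) a_b_def[symmetric] r_q_R_Q_def[symmetric] g_h_def[symmetric]
  \<comment> \<open>\<open>W\<close> is the determinant formed by the second columns at
    \<open>z\<close> and \<open>w\<close>. Since it enters the two mixed brackets with opposite
    signs, these cancel, which annihilates the term \<open>m g (a + b)\<close> left in the new
    bracket of the two \<open>peak_r\<close>.\<close>
  have ab: "a = - b"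
  proof -
    have "(w - z) * (a + b) = 0" using IH(3,4) by (simp add: algebra_simps)
    then show ?thesis using \<open>z \<noteq> w\<close> by simp
  qed
  have "pbracket peakon_poisson (peak_r m z (Suc k)) (peak_r m w (Suc k)) x = 0"
    by (simp add: expand) (simp add: algebra_simps ab)
  \<comment> \<open>The last factor is zero by \<open>IH(4)\<close>.\<close>
  moreover have "pbracket peakon_poisson (peak_q m z (Suc k)) (peak_q m w (Suc k)) x
      = m (site k) * h * ((w - z) * b - (q * (1 - w * R) - (1 - z * r) * Q))"
    by (simp add: expand) (simp add: algebra_simps ab)
  moreover have "pbracket peakon_poisson (peak_q m z (Suc k)) (peak_r m w (Suc k)) x
      = a + m (site k) * g * q * Q + (m (site k))\<^sup>2 * g * h * ((1 - z * r) * Q - z * b)"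
    by (simp add: expand) (simp add: algebra_simps power2_eq_square)
  moreover have "pbracket peakon_poisson (peak_r m z (Suc k)) (peak_q m w (Suc k)) x
      = b - m (site k) * g * q * Q - (m (site k))\<^sup>2 * g * h * (q * (1 - w * R) + w * a)"
    by (simp add: expand) (simp add: algebra_simps power2_eq_square)
  moreover have "W (Suc k) = (q + m (site k) * h * (1 - z * r)) * (1 - w * (R + m (site k) * g * Q))
      - (1 - z * (r + m (site k) * g * q)) * (Q + m (site k) * h * (1 - w * R))"
    by (simp add: W_def r_q_R_Q_def g_h_def algebra_simps)
  \<comment> \<open>Once \<open>(w - z) * a\<close> and \<open>(w - z) * b\<close> are replaced by
    the induction hypothesis, this and the next claim are polynomial identities.\<close>
  moreover have "(w - z) * (a + m (site k) * g * q * Q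
        + (m (site k))\<^sup>2 * g * h * ((1 - z * r) * Q - z * b))
      = - ((q + m (site k) * h * (1 - z * r)) * (1 - w * (R + m (site k) * g * Q))
      - (1 - z * (r + m (site k) * g * q)) * (Q + m (site k) * h * (1 - w * R)))"
    using IH(3,4) by algebra
  moreover have "(w - z) * (b - m (site k) * g * q * Q
        - (m (site k))\<^sup>2 * g * h * (q * (1 - w * R) + w * a))
      = (q + m (site k) * h * (1 - z * r)) * (1 - w * (R + m (site k) * g * Q))
      - (1 - z * (r + m (site k) * g * q)) * (Q + m (site k) * h * (1 - w * R))"
    using IH(3,4) by algebra
  ultimately show ?case using IH(4) by simp
qed

section \<open>The Hamiltonian\<close>

lemma open_peakon_domain: "open (peakon_domain :: (real^'n::{finite,linorder}) set)"
proof -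
  have "peakon_domain = (\<Inter>i. \<Inter>j\<in>{j. i < j}. {x :: (real, 'n) vec. x $ i < x $ j})"
    by (auto simp: peakon_domain_def)
  also have "open \<dots>"
    by (intro open_INT finite ballI open_Collect_less continuous_intros)
  finally show ?thesis .
qed

lemma sum_symmetric_square:
  fixes w :: "nat \<Rightarrow> nat \<Rightarrow> real"
  assumes "\<And>a b. w a b = w b a"
  shows "(\<Sum>a<n. \<Sum>b<n. w a b) = (\<Sum>a<n. w a a) + 2 * (\<Sum>b<n. \<Sum>a<b. w a b)"
proof (induction n)
  case (Suc n)
  have "(\<Sum>b<n. w n b) = (\<Sum>a<n. w a n)" by (simp add: assms)
  then show ?case using Suc by (simp add: sum.distrib algebra_simps)
qed simp

lemma peak_q_0: "peak_q m 0 k x = (\<Sum>a<k. m (site a) * exp (x $ site a))"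
  by (induction k) auto

text \<open>At parameter 0 the factor \<open>1 - z * peak_r\<close> becomes 1, so the recursion
  merely accumulates the pair interactions.\<close>

lemma peak_r_0:
  "peak_r m 0 k x = (\<Sum>b<k. \<Sum>a<b. m (site a) * m (site b) * exp (x $ site a - x $ site b))"
  by (induction k)
    (auto simp: peak_q_0 sum_distrib_left exp_diff exp_minus field_simps intro!: sum.cong)

lemma peakon_ham_eq_peak_r:
  fixes m :: "'n::{finite,linorder} \<Rightarrow> real"
  assumes x: "x \<in> peakon_domain"
  shows "peakon_ham m x = (\<Sum>i\<in>UNIV. (m i)\<^sup>2) + 2 * peak_r m 0 (CARD('n)) x"
proof -
  define w where "w a b = m (site a) * m (site b) * exp (- \<bar>x $ site a - x $ site b\<bar>)" for a b
  have "peakon_ham m x = (\<Sum>a<CARD('n). \<Sum>b<CARD('n). w a b)"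
    by (simp add: peakon_ham_def sum_site w_def)
  also have "\<dots> = (\<Sum>a<CARD('n). w a a) + 2 * (\<Sum>b<CARD('n). \<Sum>a<b. w a b)"
    by (rule sum_symmetric_square) (simp add: w_def abs_minus_commute mult.commute)
  also have "(\<Sum>a<CARD('n). w a a) = (\<Sum>i\<in>UNIV. (m i)\<^sup>2)"
    by (simp add: sum_site w_def power2_eq_square)
  also have "(\<Sum>b<CARD('n). \<Sum>a<b. w a b) = peak_r m 0 (CARD('n)) x"
    unfolding peak_r_0
  proof (intro sum.cong refl)
    fix b a assume "b \<in> {..<CARD('n)}" "a \<in> {..<b}"
    then have "x $ site a < x $ site b"
      using x site_strict_mono[where 'n='n] by (auto simp: peakon_domain_def)
    then show "w a b = m (site a) * m (site b) * exp (x $ site a - x $ site b)"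
      by (simp add: w_def)
  qed
  finally show ?thesis .
qed

lemma pbracket_peakon_ham:
  fixes m :: "'n::{finite,linorder} \<Rightarrow> real"
  assumes x: "x \<in> peakon_domain"
  shows "pbracket P f (peakon_ham m) x = 2 * pbracket P f (peak_r m 0 (CARD('n))) x"
proof -
  have "pd (peakon_ham m) k x = 2 * pd (peak_r m 0 (CARD('n))) k x" for k
    by (subst pd_transform_open[OF open_peakon_domain x peakon_ham_eq_peak_r])
      (auto simp: pd_add pd_mult expsum_mult expsum.add)
  then show ?thesis by (simp add: pbracket_def sum_distrib_left mult.assoc mult.left_commute)
qed

text \<open>On the domain the Hamiltonian is an exponential sum with constant exponent vectors
  \<open>a i k\<close>. Contracting \<open>a i k\<close> with row \<open>j\<close> of the Poisson
  matrix gives an integer weight for each pair of indices, and sorting the pairs by their position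
  relative to \<open>j\<close> gives the peakon equations.\<close>

lemma peakon_field_eq_ham_field:
  fixes m :: "'n::{finite,linorder} \<Rightarrow> real"
  assumes x: "x \<in> peakon_domain"
  shows "peakon_field m x = ham_field peakon_poisson (peakon_ham m) x"
proof (rule vec_eq_iff[THEN iffD2, rule_format])
  fix j
  define \<sigma> :: "'n \<Rightarrow> 'n \<Rightarrow> real" where "\<sigma> i k = (if i < k then - 1 else if k < i then 1 else 0)" for i k
  define w where "w i k = m i * m k * exp (- \<bar>x $ i - x $ k\<bar>)" for i k
  define a where "a i k = - \<sigma> i k *\<^sub>R (axis i 1 - axis k (1::real))" for i k
  have w_sym: "w i k = w k i" for i k by (simp add: w_def abs_minus_commute mult.commute)
  have sig: "sgn (y $ i - y $ k) = \<sigma> i k" if "y \<in> peakon_domain" for y i k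
    using that by (cases i k rule: linorder_cases) (auto simp: \<sigma>_def peakon_domain_def)
  have a_inner: "a i k \<bullet> y = - \<bar>y $ i - y $ k\<bar>" if "y \<in> peakon_domain" for y i k
    by (simp add: a_def inner_diff_left inner_axis' abs_sgn sig[OF that] mult.commute)
  have ham: "peakon_ham m y = (\<Sum>i\<in>UNIV. \<Sum>k\<in>UNIV. (m i * m k) * exp (a i k \<bullet> y))"
    if "y \<in> peakon_domain" for y
    by (simp add: peakon_ham_def a_inner[OF that])
  have pd: "pd (peakon_ham m) l x = (\<Sum>i\<in>UNIV. \<Sum>k\<in>UNIV. w i k * a i k $ l)" for l
    by (subst pd_transform_open[OF open_peakon_domain x ham])
      (auto intro!: expsum_sum expsum.exp simp: pd_sum pd_expsum_term expsum_sum expsum.exp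
        a_inner[OF x] w_def)
  have row: "(\<Sum>l\<in>UNIV. \<sigma> j l * a i k $ l) = \<sigma> k i * (\<sigma> j i - \<sigma> j k)" for i k
  proof -
    have "(\<Sum>l\<in>UNIV. \<sigma> j l * a i k $ l) = (\<chi> l. \<sigma> j l) \<bullet> a i k"
      by (simp add: inner_vec_def)
    also have "\<dots> = - \<sigma> i k * (\<sigma> j i - \<sigma> j k)"
      by (simp add: a_def inner_diff_right inner_axis)
    also have "- \<sigma> i k = \<sigma> k i" by (auto simp: \<sigma>_def)
    finally show ?thesis .
  qed
  have "ham_field peakon_poisson (peakon_ham m) x $ j =
      (\<Sum>l\<in>UNIV. \<sigma> j l * (\<Sum>i\<in>UNIV. \<Sum>k\<in>UNIV. w i k * a i k $ l))"
    by (simp add: ham_field_def pd peakon_poisson_def sig[OF x])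
  also have "\<dots> = (\<Sum>l\<in>UNIV. \<Sum>i\<in>UNIV. \<Sum>k\<in>UNIV. w i k * (\<sigma> j l * a i k $ l))"
    by (simp add: sum_distrib_left mult.left_commute)
  also have "\<dots> = (\<Sum>i\<in>UNIV. \<Sum>k\<in>UNIV. \<Sum>l\<in>UNIV. w i k * (\<sigma> j l * a i k $ l))"
    by (subst sum.swap, rule sum.cong[OF refl], rule sum.swap)
  also have "\<dots> = (\<Sum>i\<in>UNIV. \<Sum>k\<in>UNIV. w i k * (\<sigma> k i * (\<sigma> j i - \<sigma> j k)))"
    by (simp only: sum_distrib_left[symmetric] row)
  \<comment> \<open>The weight is 1 if exactly one of \<open>i\<close>, \<open>k\<close> equals
    \<open>j\<close>, 2 if \<open>j\<close> lies strictly between them, and 0 otherwise. Both orders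
    of a pair contribute, whence the factors 2 and 4 below.\<close>
  also have "\<dots> = (\<Sum>i\<in>UNIV. \<Sum>k\<in>UNIV.
      (if i = j then if k \<noteq> j then w j k else 0 else 0) +
      (if k = j then if i \<noteq> j then w j i else 0 else 0) +
      (if i < j then if j < k then 2 * w i k else 0 else 0) +
      (if k < j then if j < i then 2 * w k i else 0 else 0))"
  proof (intro sum.cong refl)
    fix i k
    have s: "\<sigma> a b = - 1" "\<sigma> b a = 1" if "a < b" for a b using that by (auto simp: \<sigma>_def)
    have e: "\<sigma> a a = 0" for a by (simp add: \<sigma>_def)
    consider "i < j" "j < k" | "i < j" "k = j" | "i < j" "k < j"
      | "i = j" "k < j" | "i = j" "k = j" | "i = j" "j < k"
      | "j < i" "k < j" | "j < i" "k = j" | "j < i" "j < k"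
      by (meson linorder_less_linear)
    then show "w i k * (\<sigma> k i * (\<sigma> j i - \<sigma> j k)) =
      (if i = j then if k \<noteq> j then w j k else 0 else 0) +
      (if k = j then if i \<noteq> j then w j i else 0 else 0) +
      (if i < j then if j < k then 2 * w i k else 0 else 0) +
      (if k < j then if j < i then 2 * w k i else 0 else 0)"
      by cases (auto simp: s e w_sym)
  qed
  also have "\<dots> = 2 * (\<Sum>k\<in>UNIV. if k \<noteq> j then w j k else 0)
      + 4 * (\<Sum>i\<in>UNIV. \<Sum>k\<in>UNIV. if i < j then if j < k then w i k else 0 else 0)"
  proof -
    have 1: "(\<Sum>i\<in>UNIV. \<Sum>k\<in>UNIV. if i = j then if k \<noteq> j then w j k else 0 else 0)
        = (\<Sum>k\<in>UNIV. if k \<noteq> j then w j k else 0)"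
      by (subst sum.swap) simp
    have 2: "(\<Sum>i\<in>UNIV. \<Sum>k\<in>UNIV. if k = j then if i \<noteq> j then w j i else 0 else 0)
        = (\<Sum>k\<in>UNIV. if k \<noteq> j then w j k else 0)"
      by simp
    have 3: "(\<Sum>i\<in>UNIV. \<Sum>k\<in>UNIV. if i < j then if j < k then 2 * w i k else 0 else 0)
        = 2 * (\<Sum>i\<in>UNIV. \<Sum>k\<in>UNIV. if i < j then if j < k then w i k else 0 else 0)"
      by (simp add: sum_distrib_left if_distrib[of "\<lambda>y. 2 * y"] cong: if_cong)
    have 4: "(\<Sum>i\<in>UNIV. \<Sum>k\<in>UNIV. if k < j then if j < i then 2 * w k i else 0 else 0)
        = (\<Sum>i\<in>UNIV. \<Sum>k\<in>UNIV. if i < j then if j < k then 2 * w i k else 0 else 0)"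
      by (rule sum.swap)
    show ?thesis by (simp only: sum.distrib 1 2 3 4)
  qed
  also have "\<dots> = 2 * (\<Sum>k\<in>{k. k \<noteq> j}. w j k) + 4 * (\<Sum>i\<in>{i. i < j}. \<Sum>k\<in>{k. j < k}. w i k)"
  proof -
    have "(\<Sum>k\<in>UNIV. if i < j then if j < k then w i k else 0 else 0) =
      (if i < j then \<Sum>k\<in>{k. j < k}. w i k else 0)" for i
      by (simp flip: sum.inter_filter)
    then show ?thesis by (simp flip: sum.inter_filter)
  qed
  finally show "peakon_field m x $ j = ham_field peakon_poisson (peakon_ham m) x $ j"
    by (simp add: peakon_field_def w_def)
qed

section \<open>The Casimir and the rank\<close>

definition site_index :: "'n::{finite,linorder} \<Rightarrow> nat" where
  "site_index = the_inv_into {..<CARD('n)} site"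

lemma site_index_site [simp]:
  "k < CARD('n) \<Longrightarrow> site_index (site k :: 'n::{finite,linorder}) = k"
  unfolding site_index_def using bij_betw_site[where 'n='n]
  by (auto simp: bij_betw_def intro: the_inv_into_f_f)

definition alt_vec :: "real^'n::{finite,linorder}" where
  "alt_vec = (\<chi> i. (- 1) ^ site_index i)"

text \<open>The exponential is taken so that this function too is an exponential sum.\<close>

definition peak_casimir :: "(real, 'n::{finite,linorder}) vec \<Rightarrow> real" where
  "peak_casimir x = exp (alt_vec \<bullet> x)"

lemma peak_casimir_eq_term: "peak_casimir = (\<lambda>x. 1 * exp (alt_vec \<bullet> x))"
  by (simp add: peak_casimir_def fun_eq_iff)

text \<open>The sign of \<open>k - j\<close> is twice the indicator of \<open>j < k\<close>, plus
  that of \<open>j = k\<close>, minus 1.\<close>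

lemma sum_sgn_row:
  fixes v :: "nat \<Rightarrow> real"
  assumes "k < n"
  shows "(\<Sum>j<n. sgn (real k - real j) * v j) = 2 * (\<Sum>j<k. v j) + v k - (\<Sum>j<n. v j)"
proof -
  have "(\<Sum>j<n. sgn (real k - real j) * v j) =
      (\<Sum>j<n. 2 * (if j < k then v j else 0) + (if j = k then v j else 0) - v j)"
    by (intro sum.cong refl) (auto simp: sgn_if)
  also have "\<dots> = 2 * (\<Sum>j<n. if j < k then v j else 0) + v k - (\<Sum>j<n. v j)"
    using assms by (simp add: sum.distrib sum_subtractf sum_distrib_left)
  also have "(\<Sum>j<n. if j < k then v j else 0) = (\<Sum>j<k. v j)"
    using assms by (intro sum.mono_neutral_cong_right) auto
  finally show ?thesis .
qed

lemma alternating_sum: "(\<Sum>j<k. (- 1) ^ j) = (if even k then 0 else 1 :: real)"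
  by (induction k) auto

lemma peakon_poisson_mult:
  fixes x :: "real^'n::{finite,linorder}"
  assumes "x \<in> peakon_domain" "k < CARD('n)"
  shows "(peakon_poisson x *v v) $ site k =
    2 * (\<Sum>j<k. v $ site j) + v $ site k - (\<Sum>j<CARD('n). v $ site j)"
  using sum_sgn_row[OF assms(2), of "\<lambda>j. v $ site j"]
  by (simp add: matrix_vector_mult_def sum_site peakon_poisson_site assms)

text \<open>For odd \<open>n\<close> the alternating vector lies in the kernel of the Poisson
  matrix: its total sum is 1, and its partial sums alternate between 0 and 1.\<close>

lemma pbracket_peak_casimir:
  fixes x :: "real^'n::{finite,linorder}"
  assumes x: "x \<in> peakon_domain" and "odd (CARD('n))"
  shows "pbracket peakon_poisson f peak_casimir x = 0"
proof -
  have ker: "(\<Sum>k\<in>UNIV. peakon_poisson x $ i $ k * alt_vec $ k) = 0" for i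
  proof -
    obtain a where a: "a < CARD('n)" "i = site a" using ex_site by blast
    have "(peakon_poisson x *v alt_vec) $ site a =
      2 * (\<Sum>j<a. (-1)^j) + (-1)^a - (\<Sum>j<CARD('n). (-1)^j)"
      using a x by (simp add: peakon_poisson_mult alt_vec_def)
    also have "\<dots> = 0" using assms(2) by (simp add: alternating_sum)
    finally show ?thesis by (simp add: matrix_vector_mult_def a)
  qed
  have pd: "pd peak_casimir k x = exp (alt_vec \<bullet> x) * alt_vec $ k" for k
    unfolding peak_casimir_eq_term by (subst pd_expsum_term) simp
  have "pbracket peakon_poisson f peak_casimir x = (\<Sum>i\<in>UNIV. pd f i x *
      (exp (alt_vec \<bullet> x) * (\<Sum>k\<in>UNIV. peakon_poisson x $ i $ k * alt_vec $ k)))"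
    by (simp add: pbracket_def pd sum_distrib_left mult.assoc mult.left_commute)
  then show ?thesis by (simp add: ker)
qed

text \<open>Subtracting consecutive rows leaves \<open>v $ site k + v $ site (Suc k) = 0\<close>, so
  the kernel contains at most multiples of the alternating vector.\<close>

lemma peakon_poisson_kernel:
  fixes x :: "real^'n::{finite,linorder}"
  assumes x: "x \<in> peakon_domain" and v: "peakon_poisson x *v v = 0" and "k < CARD('n)"
  shows "v $ site k = (- 1) ^ k * v $ site 0"
  using assms(3)
proof (induction k)
  case (Suc k)
  have "(peakon_poisson x *v v) $ site (Suc k) - (peakon_poisson x *v v) $ site k = 0"
    by (simp add: v)
  then have "v $ site (Suc k) = - v $ site k"
    using Suc.prems x by (simp add: peakon_poisson_mult algebra_simps)
  with Suc show ?case by simp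
qed simp

lemma peakon_poisson_kernel_trivial:
  fixes x :: "real^'n::{finite,linorder}"
  assumes "x \<in> peakon_domain" "peakon_poisson x *v v = 0" "v $ site 0 = 0"
  shows "v = 0"
proof (rule vec_eq_iff[THEN iffD2, rule_format])
  fix i :: 'n
  obtain a where "a < CARD('n)" "i = site a" using ex_site by blast
  then show "v $ i = 0 $ i" using peakon_poisson_kernel[OF assms(1,2)] assms(3) by simp
qed

text \<open>For even \<open>n\<close> a kernel vector has sum zero, so row 0 forces its first entry,
  hence the vector, to vanish. For odd \<open>n\<close> the matrix is injective on the hyperplane of
  vanishing first entry, so the rank is \<open>n - 1\<close> or \<open>n\<close>, and both have the
  same integer half.\<close>

lemma rank_peakon_poisson:
  fixes x :: "real^'n::{finite,linorder}"
  assumes x: "x \<in> peakon_domain"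
  shows "rank (peakon_poisson x) div 2 = CARD('n) div 2"
proof (cases "even (CARD('n))")
  case True
  have "v = 0" if v: "peakon_poisson x *v v = 0" for v
  proof (rule peakon_poisson_kernel_trivial[OF x v])
    have "(\<Sum>j<CARD('n). v $ site j) = (\<Sum>j<CARD('n). (- 1) ^ j) * v $ site 0"
      unfolding sum_distrib_right by (intro sum.cong refl peakon_poisson_kernel[OF x v]) simp
    also have "\<dots> = 0" using True by (simp add: alternating_sum)
    finally show "v $ site 0 = 0"
      using peakon_poisson_mult[OF x, of 0 v] v by simp
  qed
  then have "inj ((*v) (peakon_poisson x))"
    by (simp add: linear_injective_0[OF matrix_vector_mul_linear])
  then have "rank (peakon_poisson x) = CARD('n)" by (simp only: full_rank_injective)
  then show ?thesis by simp
next
  case False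
  let ?S = "{v :: (real, 'n) vec. axis (site 0) 1 \<bullet> v = 0}"
  have "inj_on ((*v) (peakon_poisson x)) ?S"
    using peakon_poisson_kernel_trivial[OF x]
    by (simp add: linear_injective_on_subspace_0[OF matrix_vector_mul_linear subspace_hyperplane])
      (auto simp: inner_axis')
  then have "dim ((*v) (peakon_poisson x) ` ?S) = dim ?S"
    by (intro dim_image_eq) (auto simp: span_eq_iff[THEN iffD2, OF subspace_hyperplane])
  also have "\<dots> = CARD('n) - 1"
    by (subst dim_hyperplane) (auto simp: axis_eq_0_iff)
  finally have "CARD('n) - 1 \<le> rank (peakon_poisson x)"
    unfolding rank_dim_range by (metis dim_subset image_mono subset_UNIV)
  moreover have "rank (peakon_poisson x) \<le> CARD('n)"
    using rank_bound[of "peakon_poisson x"] by simp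
  ultimately show ?thesis using False by presburger
qed

lemma site_index_less_iff:
  fixes i j :: "'n::{finite,linorder}"
  shows "site_index i < site_index j \<longleftrightarrow> i < j"
  using ex_site[of i] ex_site[of j] by (auto simp: site_less_iff)

lemma peakon_domain_nonempty: "(\<chi> i. real (site_index i)) \<in> peakon_domain"
  by (simp add: peakon_domain_def site_index_less_iff)

lemma poisson_rank_peakon:
  "poisson_rank peakon_domain (peakon_poisson :: (real, 'n::{finite,linorder}) vec \<Rightarrow> _) div 2
    = CARD('n) div 2"
proof -
  let ?R = "(\<lambda>x :: (real, 'n) vec. rank (peakon_poisson x)) ` peakon_domain"
  \<comment> \<open>The domain is infinite or a point, but the set of ranks is bounded, so
    \<open>Max\<close> is attained.\<close>
  have "?R \<subseteq> {..CARD('n)}" using rank_bound[where 'm='n and 'n='n] by auto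
  then have "finite ?R" by (rule finite_subset) simp
  then have "Max ?R \<in> ?R" using peakon_domain_nonempty by (intro Max_in) auto
  then show ?thesis unfolding poisson_rank_def using rank_peakon_poisson by auto
qed

section \<open>Widely separated pairs of peakons\<close>

lemma tendsto_det:
  fixes A :: "'a \<Rightarrow> real^'n^'n"
  assumes "\<And>i j. ((\<lambda>t. A t $ i $ j) \<longlongrightarrow> L $ i $ j) F"
  shows "((\<lambda>t. det (A t)) \<longlongrightarrow> det L) F"
  unfolding det_def by (intro tendsto_intros assms)

text \<open>Up to the nonzero factors \<open>d\<close>, the gradients are distinct rows of an
  invertible matrix. A linear relation among them, padded by zeros, is a relation among all
  rows.\<close>

lemma indep_at_if_det_nonzero:
  fixes B :: "real^'n^'n"
  assumes R: "inj_on R {..<s}"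
    and B: "\<And>a. a < s \<Longrightarrow> B $ R a = d a *\<^sub>R grad (F a) x"
    and d: "\<And>a. a < s \<Longrightarrow> d a \<noteq> 0"
    and "det B \<noteq> 0"
  shows "indep_at s F x"
  unfolding indep_at_def
proof (intro allI impI)
  fix c a assume c: "(\<Sum>i<s. c i *\<^sub>R grad (F i) x) = 0" and a: "a < s"
  define c' where "c' i = (if i \<in> R ` {..<s}
    then c (the_inv_into {..<s} R i) / d (the_inv_into {..<s} R i) else 0)" for i
  have c'R: "c' (R b) = c b / d b" if "b < s" for b
    using that by (simp add: c'_def the_inv_into_f_f[OF R])
  have "(\<Sum>i\<in>UNIV. c' i *s row i B) = (\<Sum>i\<in>R ` {..<s}. c' i *s row i B)"
    by (intro sum.mono_neutral_right) (auto simp: c'_def)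
  also have "\<dots> = (\<Sum>b<s. c' (R b) *s row (R b) B)"
    by (simp add: sum.reindex[OF R])
  also have "\<dots> = (\<Sum>b<s. c b *\<^sub>R grad (F b) x)"
  proof (intro sum.cong refl)
    fix b assume "b \<in> {..<s}"
    then show "c' (R b) *s row (R b) B = c b *\<^sub>R grad (F b) x"
      using d[of b] by (simp add: c'R row_def vec_eq_iff B)
  qed
  also have "\<dots> = 0" by (rule c)
  finally have "\<forall>i. c' i = 0"
    using \<open>det B \<noteq> 0\<close> matrix_right_invertible_independent_rows[of B]
    unfolding invertible_det_nz[symmetric] invertible_right_inverse by blast
  then show "c a = 0" using c'R[OF a] d[OF a] by simp
qed

text \<open>
  The weight \<open>e\<close> compensates the growth of \<open>peak_q\<close> along a curve \<open>y\<close> on which the peakons move apart.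
\<close>

definition peak_limit where
  "peak_limit m z k e y P Q D E \<longleftrightarrow>
    ((\<lambda>t::real. 1 - z * peak_r m z k (y t)) \<longlongrightarrow> P) at_top \<and>
    ((\<lambda>t. e t * peak_q m z k (y t)) \<longlongrightarrow> Q) at_top \<and>
    (\<forall>j. ((\<lambda>t. - z * pd (peak_r m z k) j (y t)) \<longlongrightarrow> D j) at_top) \<and>
    (\<forall>j. ((\<lambda>t. e t * pd (peak_q m z k) j (y t)) \<longlongrightarrow> E j) at_top)"

text \<open>The choice \<open>exp (y t $ site k) = c / e t\<close> balances the weight:
  \<open>e\<close> cancels against \<open>exp (x $ site k)\<close> and supplies the weight of
  \<open>peak_q\<close> against \<open>exp (- x $ site k)\<close>, so one recursion step passes to
  the limit.\<close>

lemma peak_limit_Suc: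
  assumes lim: "peak_limit m z k e y P Q D E"
    and e: "\<And>t. e t > 0" and c: "c > 0" and y: "\<And>t. exp (y t $ site k) = c / e t"
  shows "peak_limit m z (Suc k) e y (P - z * m (site k) / c * Q) (Q + m (site k) * c * P)
    (\<lambda>j. D j - z * m (site k) / c * (E j - (if j = site k then Q else 0)))
    (\<lambda>j. E j + m (site k) * c * (D j + (if j = site k then P else 0)))"
proof -
  have y': "exp (- y t $ site k) = e t / c" for t using y[of t] by (simp add: exp_minus)
  have e0: "e t \<noteq> 0" for t using e[of t] by simp
  have P: "((\<lambda>t. 1 - z * peak_r m z k (y t)) \<longlongrightarrow> P) at_top"
    and Q: "((\<lambda>t. e t * peak_q m z k (y t)) \<longlongrightarrow> Q) at_top"
    and D: "((\<lambda>t. - z * pd (peak_r m z k) j (y t)) \<longlongrightarrow> D j) at_top"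
    and E: "((\<lambda>t. e t * pd (peak_q m z k) j (y t)) \<longlongrightarrow> E j) at_top" for j
    using lim unfolding peak_limit_def by auto
  have "((\<lambda>t. 1 - z * peak_r m z k (y t) - z * m (site k) / c * (e t * peak_q m z k (y t)))
      \<longlongrightarrow> P - z * m (site k) / c * Q) at_top"
    by (intro tendsto_intros P Q)
  moreover have "((\<lambda>t. e t * peak_q m z k (y t) + m (site k) * c * (1 - z * peak_r m z k (y t)))
      \<longlongrightarrow> Q + m (site k) * c * P) at_top"
    by (intro tendsto_intros P Q)
  moreover have "((\<lambda>t. - z * pd (peak_r m z k) j (y t) - z * m (site k) / c *
        (e t * pd (peak_q m z k) j (y t) - (if j = site k then e t * peak_q m z k (y t) else 0)))
      \<longlongrightarrow> D j - z * m (site k) / c * (E j - (if j = site k then Q else 0))) at_top" for j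
    by (cases "j = site k") (simp only: if_True if_False simp_thms, intro tendsto_intros D E Q)+
  moreover have "((\<lambda>t. e t * pd (peak_q m z k) j (y t) + m (site k) * c *
        (- z * pd (peak_r m z k) j (y t) + (if j = site k then 1 - z * peak_r m z k (y t) else 0)))
      \<longlongrightarrow> E j + m (site k) * c * (D j + (if j = site k then P else 0))) at_top" for j
    by (cases "j = site k") (simp only: if_True if_False simp_thms, intro tendsto_intros D E P)+
  moreover have "1 - z * peak_r m z (Suc k) (y t) =
      1 - z * peak_r m z k (y t) - z * m (site k) / c * (e t * peak_q m z k (y t))" for t
    by (simp add: y' algebra_simps)
  moreover have "e t * peak_q m z (Suc k) (y t) =
      e t * peak_q m z k (y t) + m (site k) * c * (1 - z * peak_r m z k (y t))" for t
    using e0[of t] by (simp add: y field_simps)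
  moreover have "- z * pd (peak_r m z (Suc k)) j (y t) =
      - z * pd (peak_r m z k) j (y t) - z * m (site k) / c *
        (e t * pd (peak_q m z k) j (y t) - (if j = site k then e t * peak_q m z k (y t) else 0))"
    for j t
    unfolding pd_peak_Suc y' by (simp add: algebra_simps)
  moreover have "e t * pd (peak_q m z (Suc k)) j (y t) =
      e t * pd (peak_q m z k) j (y t) + m (site k) * c *
        (- z * pd (peak_r m z k) j (y t) + (if j = site k then 1 - z * peak_r m z k (y t) else 0))"
    for j t
    unfolding pd_peak_Suc y using e0[of t] by (simp add: field_simps)
  ultimately show ?thesis unfolding peak_limit_def by (simp only:) blast
qed

text \<open>Decouples consecutive pairs: on the larger scale of the next pair the old
  \<open>peak_q\<close> is negligible.\<close>

lemma peak_limit_rescale: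
  assumes lim: "peak_limit m z k e y P Q D E" and f: "(f \<longlongrightarrow> 0) at_top"
  shows "peak_limit m z k (\<lambda>t. f t * e t) y P 0 D (\<lambda>_. 0)"
proof -
  have "((\<lambda>t. f t * (e t * peak_q m z k (y t))) \<longlongrightarrow> 0 * Q) at_top"
    using lim f unfolding peak_limit_def by (intro tendsto_mult) auto
  moreover have "((\<lambda>t. f t * (e t * pd (peak_q m z k) j (y t))) \<longlongrightarrow> 0 * E j) at_top" for j
    using lim f unfolding peak_limit_def by (intro tendsto_mult) auto
  ultimately show ?thesis using lim unfolding peak_limit_def by (simp add: mult.assoc)
qed

text \<open>
  The sites \<open>2l\<close> and \<open>2l + 1\<close> move together, at distance such that
  \<open>m\<^sub>2\<^sub>l m\<^sub>2\<^sub>l\<^sub>+\<^sub>1 exp (x\<^sub>2\<^sub>l - x\<^sub>2\<^sub>l\<^sub>+\<^sub>1) = 1 / (l + 1)\<close>, while distinct pairs separate.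
  The distance may be negative: the curve need not lie in the domain.
  In the limit \<open>1 - z peak_r\<close> factorises over the pairs, and for \<open>z = a + 1\<close> the \<open>a\<close>-th factor
  vanishes, so that only its derivative survives in the gradient.
\<close>

definition peak_curve :: "('n::{finite,linorder} \<Rightarrow> real) \<Rightarrow> real \<Rightarrow> (real, 'n) vec" where
  "peak_curve m t = (\<chi> i. t * real (site_index i div 2) + (if odd (site_index i)
     then ln (real (Suc (site_index i div 2)) * (m (site (site_index i - 1)) * m i)) else 0))"

definition pair_prod :: "real \<Rightarrow> nat \<Rightarrow> real" where
  "pair_prod z i = (\<Prod>l<i. 1 - z / real (Suc l))"

text \<open>The Leibniz rule for \<open>pair_prod\<close>, whose factor \<open>l\<close> is the
  limiting value of \<open>1 - z m m' exp (x - x')\<close>, with \<open>m\<close>, \<open>x\<close>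
  and \<open>m'\<close>, \<open>x'\<close> belonging to the sites \<open>2l\<close> and
  \<open>2l + 1\<close>.\<close>

fun pair_grad :: "real \<Rightarrow> nat \<Rightarrow> 'n::{finite,linorder} \<Rightarrow> real" where
  "pair_grad z 0 j = 0"
| "pair_grad z (Suc i) j = (1 - z / real (Suc i)) * pair_grad z i j + z / real (Suc i) * pair_prod z i *
     ((if j = site (2 * i + 1) then 1 else 0) - (if j = site (2 * i) then 1 else 0))"

text \<open>Composes the two recursion steps inside one pair. It serves the gradient, with
  \<open>X\<close> and \<open>Y\<close> marking the two sites, and with \<open>P = 0\<close> also
  the value.\<close>

lemma pair_step_algebra:
  fixes u v :: real
  assumes "u \<noteq> 0" "v \<noteq> 0" "s \<noteq> 0"
  shows "G - z * v / (s * (u * v)) * (u * (G + P * X) - u * P * Y)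
    = (1 - z / s) * G + z / s * P * (Y - X)"
  using assms by (simp add: field_simps)

lemma peak_limit_pairs:
  fixes m :: "'n::{finite,linorder} \<Rightarrow> real"
  assumes m: "\<forall>i. m i > 0" and "2 * i \<le> CARD('n)"
  shows "peak_limit m z (2 * i) (\<lambda>t. exp (- t * real i)) (peak_curve m)
    (pair_prod z i) 0 (pair_grad z i) (\<lambda>_. 0)"
  using assms(2)
proof (induction i)
  case 0
  show ?case by (simp add: peak_limit_def pair_prod_def)
next
  case (Suc i)
  let ?u = "m (site (2 * i))" and ?v = "m (site (Suc (2 * i)))"
  define c where "c = real (Suc i) * (?u * ?v)"
  have pos: "?u > 0" "?v > 0" "c > 0" using m by (simp_all add: c_def)
  \<comment> \<open>The first site of a pair has no logarithmic offset, so its constant is 1; the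
    offset of the second site produces \<open>c\<close>.\<close>
  have "exp (peak_curve m t $ site (2 * i)) = 1 / exp (- t * real i)" for t
    using Suc.prems by (simp add: peak_curve_def exp_minus inverse_eq_divide)
  from peak_limit_Suc[OF Suc.IH _ _ this]
  have 1: "peak_limit m z (Suc (2 * i)) (\<lambda>t. exp (- t * real i)) (peak_curve m)
    (pair_prod z i) (?u * pair_prod z i) (pair_grad z i)
    (\<lambda>j. ?u * (pair_grad z i j + (if j = site (2 * i) then pair_prod z i else 0)))"
    using Suc.prems by (simp cong: if_cong)
  have "exp (peak_curve m t $ site (Suc (2 * i))) = c / exp (- t * real i)" for t
    using Suc.prems pos by (simp add: peak_curve_def exp_minus exp_add c_def exp_ln divide_inverse)
  \<comment> \<open>The extra factor \<open>exp (- t)\<close> yields the weight for pair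
    \<open>i + 1\<close>.\<close>
  from peak_limit_rescale[OF peak_limit_Suc[OF 1 _ pos(3) this], of "\<lambda>t. exp (- t)"]
  have 2: "peak_limit m z (Suc (Suc (2 * i))) (\<lambda>t. exp (- t) * exp (- t * real i)) (peak_curve m)
    (pair_prod z i - z * ?v / c * (?u * pair_prod z i)) 0
    (\<lambda>j. pair_grad z i j - z * ?v / c *
      (?u * (pair_grad z i j + (if j = site (2 * i) then pair_prod z i else 0))
        - (if j = site (Suc (2 * i)) then ?u * pair_prod z i else 0))) (\<lambda>_. 0)"
    using filterlim_compose[OF exp_at_bot filterlim_uminus_at_bot_at_top] by simp
  have "pair_prod z i - z * ?v / c * (?u * pair_prod z i) = pair_prod z (Suc i)"
    using pair_step_algebra[of ?u ?v "real (Suc i)" "pair_prod z i" z 0 0 0] pos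
    by (simp only: c_def pair_prod_def prod.lessThan_Suc) simp
  moreover have "pair_grad z i j - z * ?v / c *
      (?u * (pair_grad z i j + (if j = site (2 * i) then pair_prod z i else 0))
        - (if j = site (Suc (2 * i)) then ?u * pair_prod z i else 0)) = pair_grad z (Suc i) j" for j :: 'n
  proof -
    define X Y :: real where "X = (if j = site (2 * i) then 1 else 0)"
      "Y = (if j = site (Suc (2 * i)) then 1 else 0)"
    have ifs: "(if j = site (2 * i) then b else 0) = b * X"
      "(if j = site (Suc (2 * i)) then b else 0) = b * Y" for b :: real
      by (simp_all add: X_Y_def)
    show ?thesis
      unfolding ifs pair_grad.simps Suc_eq_plus1[symmetric] c_def mult_1_left
      by (rule pair_step_algebra) (use pos in auto)
  qed
  moreover have "exp (- t) * exp (- t * real i) = exp (- t * real (Suc i))" for t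
    by (simp add: exp_add[symmetric] algebra_simps)
  moreover have "2 * Suc i = Suc (Suc (2 * i))" by simp
  ultimately show ?case using 2 by (simp only:)
qed

text \<open>At step \<open>a\<close> the old gradient is multiplied by 0 and the new term enters
  with a nonzero coefficient. From then on \<open>pair_prod\<close> is 0, so later pairs only
  rescale by \<open>1 - (a + 1) / (i + 1)\<close>, which is nonzero.\<close>

lemma pair_grad_resonant:
  assumes "a < i"
  shows "\<exists>C. C \<noteq> 0 \<and> (\<forall>j::'n::{finite,linorder}. pair_grad (real (Suc a)) i j =
    C * ((if j = site (2 * a + 1) then 1 else 0) - (if j = site (2 * a) then 1 else 0)))"
  using assms
proof (induction i)
  case (Suc i)
  show ?case
  proof (cases "a = i")
    case True
    have "pair_prod (real (Suc a)) i \<noteq> 0"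
      using True by (auto simp: pair_prod_def field_simps)
    then show ?thesis using True
      by (intro exI[of _ "pair_prod (real (Suc a)) i"]) (simp del: of_nat_Suc)
  next
    case False
    with Suc.prems have "a < i" by simp
    from Suc.IH[OF this] obtain C where C: "C \<noteq> 0" "\<forall>j::'n. pair_grad (real (Suc a)) i j =
      C * ((if j = site (2 * a + 1) then 1 else 0) - (if j = site (2 * a) then 1 else 0))" by blast
    have "pair_prod (real (Suc a)) i = 0"
      using Suc.prems False by (auto simp: pair_prod_def intro!: bexI[of _ a])
    then have step: "pair_grad (real (Suc a)) (Suc i) j = (1 - real (Suc a) / real (Suc i)) * C *
      ((if j = site (2 * a + 1) then 1 else 0) - (if j = site (2 * a) then 1 else 0))" for j :: 'n
      by (simp only: pair_grad.simps C(2) mult_zero_left mult_zero_right add_0_right mult.assoc)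
    have "real (Suc a) / real (Suc i) \<noteq> 1"
      using False by (simp only: divide_eq_1_iff of_nat_eq_iff) simp
    then have "(1 - real (Suc a) / real (Suc i)) * C \<noteq> 0"
      using C(1) by (simp only: mult_eq_0_iff right_minus_eq) metis
    with step show ?thesis by blast
  qed
qed simp

text \<open>For odd \<open>n\<close> the unpaired last site leaves the limit unchanged, because the
  limits of the weighted \<open>peak_q\<close> and of its gradient are zero after complete
  pairs.\<close>

lemma peak_grad_limit:
  fixes m :: "'n::{finite,linorder} \<Rightarrow> real"
  assumes m: "\<forall>i. m i > 0"
  shows "((\<lambda>t. - z * pd (peak_r m z (CARD('n))) j (peak_curve m t))
    \<longlongrightarrow> pair_grad z (CARD('n) div 2) j) at_top"
proof (cases "even (CARD('n))")
  case True
  then show ?thesis using peak_limit_pairs[OF m, of "CARD('n) div 2" z]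
    by (simp add: peak_limit_def)
next
  case False
  define K where "K = CARD('n) div 2"
  have n: "CARD('n) = Suc (2 * K)" using False by (simp add: K_def)
  have "exp (peak_curve m t $ site (2 * K)) = 1 / exp (- t * real K)" for t
    by (simp add: peak_curve_def n exp_minus inverse_eq_divide)
  from peak_limit_Suc[OF peak_limit_pairs[OF m] _ _ this, of z] show ?thesis
    by (simp add: peak_limit_def n cong: if_cong)
qed

section \<open>Integrability\<close>

text \<open>The second branch is only reached for odd \<open>n\<close>, with index \<open>n div 2\<close>.\<close>

definition peak_integral :: "('n::{finite,linorder} \<Rightarrow> real) \<Rightarrow> nat \<Rightarrow> (real, 'n) vec \<Rightarrow> real" where
  "peak_integral m a =
    (if a < CARD('n) div 2 then peak_r m (real (Suc a)) (CARD('n)) else peak_casimir)"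

lemma expsum_peak_casimir [intro, simp]: "expsum peak_casimir"
  unfolding peak_casimir_eq_term by (rule expsum.exp)

lemma expsum_peak_integral: "expsum (peak_integral m a)"
  by (simp add: peak_integral_def)

lemma pbracket_peak_integral:
  fixes m :: "'n::{finite,linorder} \<Rightarrow> real"
  assumes x: "x \<in> peakon_domain"
    and "a < CARD('n) - CARD('n) div 2" "b < CARD('n) - CARD('n) div 2"
  shows "pbracket peakon_poisson (peak_integral m a) (peak_integral m b) x = 0"
proof -
  have cas: "pbracket peakon_poisson f peak_casimir x = 0"
      "pbracket peakon_poisson peak_casimir f x = 0"
    if "\<not> c < CARD('n) div 2" "c < CARD('n) - CARD('n) div 2" for c f
  proof -
    have "odd (CARD('n))" using that by presburger
    then show "pbracket peakon_poisson f peak_casimir x = 0"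
      "pbracket peakon_poisson peak_casimir f x = 0"
      using pbracket_peak_casimir[OF x] pbracket_antisym[of peak_casimir f x] by auto
  qed
  have "pbracket peakon_poisson f f x = 0" for f :: "(real, 'n) vec \<Rightarrow> real"
    using pbracket_antisym[of f f x] by simp
  moreover have "pbracket peakon_poisson (peak_r m z (CARD('n))) (peak_r m w (CARD('n))) x = 0"
    if "z \<noteq> w" for z w using pbracket_peak[OF x that order_refl] by blast
  ultimately show ?thesis
    using cas assms by (cases "a = b") (auto simp: peak_integral_def)
qed

text \<open>The Hamiltonian belongs to parameter 0, which differs from every
  \<open>a + 1\<close>.\<close>

lemma pbracket_peak_integral_ham:
  fixes m :: "'n::{finite,linorder} \<Rightarrow> real"
  assumes x: "x \<in> peakon_domain" and a: "a < CARD('n) - CARD('n) div 2"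
  shows "pbracket peakon_poisson (peak_integral m a) (peakon_ham m) x = 0"
proof (cases "a < CARD('n) div 2")
  case True
  have "real (Suc a) \<noteq> 0" by simp
  from pbracket_peak[OF x this order_refl, of m] show ?thesis
    unfolding peak_integral_def pbracket_peakon_ham[OF x] using True by simp
next
  case False
  then have "odd (CARD('n))" using a by presburger
  then show ?thesis
    using pbracket_peak_casimir[OF x] False pbracket_antisym[of peak_casimir "peakon_ham m" x]
    by (simp add: peak_integral_def)
qed

text \<open>
  The differentials of the integrals, up to nonzero factors, completed to a square matrix by unit
  rows. The Casimir row is normalised to a constant so that it has a limit along \<open>peak_curve\<close>.
\<close>

definition peak_jacobian :: "('n::{finite,linorder} \<Rightarrow> real) \<Rightarrow> (real, 'n) vec \<Rightarrow> ((real, 'n) vec, 'n) vec" where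
  "peak_jacobian m x = (\<chi> i.
    if odd (site_index i) then
      - real (Suc (site_index i div 2)) *\<^sub>R grad (peak_r m (real (Suc (site_index i div 2))) (CARD('n))) x
    else if site_index i = 2 * (CARD('n) div 2) then alt_vec else axis i 1)"

lemma expsum_peak_jacobian:
  fixes i :: "'a::{finite,linorder}"
  shows "expsum (\<lambda>x. peak_jacobian m x $ i $ j)"
  by (cases "odd (site_index i)"; cases "site_index i = 2 * (CARD('a) div 2)")
    (simp_all add: peak_jacobian_def grad_def expsum_uminus expsum_mult expsum_pd)

lemma indep_at_peak_integral:
  fixes m :: "'n::{finite,linorder} \<Rightarrow> real"
  assumes "det (peak_jacobian m x) \<noteq> 0"
  shows "indep_at (CARD('n) - CARD('n) div 2) (peak_integral m) x"
proof (rule indep_at_if_det_nonzero[OF _ _ _ assms])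
  let ?K = "CARD('n) div 2"
  \<comment> \<open>The row of \<open>peak_jacobian\<close> that carries integral
    \<open>a\<close>.\<close>
  let ?k = "\<lambda>a. if a < ?K then 2 * a + 1 else 2 * ?K"
  have k: "?k a < CARD('n)" if "a < CARD('n) - ?K" for a using that by (auto; presburger)
  show "inj_on (\<lambda>a. site (?k a) :: 'n) {..<CARD('n) - ?K}"
  proof (rule inj_onI)
    fix a b assume ab: "a \<in> {..<CARD('n) - ?K}" "b \<in> {..<CARD('n) - ?K}"
      and "site (?k a) = (site (?k b) :: 'n)"
    then have "?k a = ?k b" using k[of a] k[of b] by (simp only: site_eq_iff lessThan_iff)
    then show "a = b" using ab by (auto split: if_splits; presburger)
  qed
  let ?d = "\<lambda>a. if a < ?K then - real (Suc a) else exp (- (alt_vec \<bullet> x))"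
  show "?d a \<noteq> 0" for a by simp
  show "peak_jacobian m x $ site (?k a) = ?d a *\<^sub>R grad (peak_integral m a) x"
    if "a < CARD('n) - ?K" for a
  proof (cases "a < ?K")
    case True
    then show ?thesis using k[OF that] by (simp add: peak_jacobian_def peak_integral_def)
  next
    case False
    have "grad peak_casimir x = exp (alt_vec \<bullet> x) *\<^sub>R (alt_vec :: (real, 'n) vec)"
      unfolding peak_casimir_eq_term grad_def by (subst pd_expsum_term) (simp add: vec_eq_iff)
    then show ?thesis using False k[OF that]
      by (simp add: peak_jacobian_def peak_integral_def exp_minus)
  qed
qed

text \<open>Along \<open>peak_curve\<close> the matrix tends to \<open>L\<close>, whose kernel is
  trivial: the unit rows kill the entries at even sites inside pairs, the resonant rows equate the
  two entries of each pair, and for odd \<open>n\<close> the alternating row kills the last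
  entry.\<close>

lemma peak_jacobian_nonsingular_somewhere:
  fixes m :: "'n::{finite,linorder} \<Rightarrow> real"
  assumes m: "\<forall>i. m i > 0"
  shows "\<exists>x. det (peak_jacobian m x) \<noteq> 0"
proof -
  let ?K = "CARD('n) div 2"
  define L :: "((real, 'n) vec, 'n) vec" where "L = (\<chi> i.
    if odd (site_index i) then (\<chi> j. pair_grad (real (Suc (site_index i div 2))) ?K j)
    else if site_index i = 2 * ?K then alt_vec else axis i 1)"
  have "((\<lambda>t. peak_jacobian m (peak_curve m t) $ i $ j) \<longlongrightarrow> L $ i $ j) at_top" for i j
    using peak_grad_limit[OF m, of "real (Suc (site_index i div 2))" j]
    by (simp add: peak_jacobian_def L_def grad_def del: of_nat_Suc)
  then have lim: "((\<lambda>t. det (peak_jacobian m (peak_curve m t))) \<longlongrightarrow> det L) at_top"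
    by (rule tendsto_det)
  have "v = 0" if v: "L *v v = 0" for v
  proof -
    have row: "(\<Sum>j\<in>UNIV. L $ i $ j * v $ j) = 0" for i
      using arg_cong[OF v, of "\<lambda>u. u $ i"] by (simp add: matrix_vector_mult_def)
    have even: "v $ site (2 * a) = 0" if "a < ?K" for a
    proof -
      have a: "2 * a < CARD('n)" "2 * a \<noteq> 2 * ?K" using that by auto
      have "(\<Sum>j\<in>UNIV. axis (site (2 * a)) 1 $ j * v $ j) = 0"
        using row[of "site (2 * a)"] a by (simp add: L_def)
      then show ?thesis using inner_axis'[of "site (2 * a)" 1 v] by (simp add: inner_vec_def)
    qed
    have odd: "v $ site (2 * a + 1) = 0" if aK: "a < ?K" for a
    proof -
      have a: "2 * a + 1 < CARD('n)" using aK by auto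
      obtain C where C: "C \<noteq> 0" "\<forall>j::'n. pair_grad (real (Suc a)) ?K j =
        C * ((if j = site (2 * a + 1) then 1 else 0) - (if j = site (2 * a) then 1 else 0))"
        using pair_grad_resonant[OF aK] by blast
      have "(\<Sum>j\<in>UNIV. pair_grad (real (Suc a)) ?K j * v $ j) = 0"
        using row[of "site (2 * a + 1)"] a by (simp add: L_def del: of_nat_Suc)
      moreover have "pair_grad (real (Suc a)) ?K j * v $ j =
          C * ((if j = site (2 * a + 1) then v $ j else 0) - (if j = site (2 * a) then v $ j else 0))"
        for j :: 'n
        unfolding C(2)[rule_format] by simp
      ultimately have "C * (v $ site (2 * a + 1) - v $ site (2 * a)) = 0"
        by (simp add: sum_subtractf flip: sum_distrib_left)
      then show ?thesis using C(1) even[OF aK] by simp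
    qed
    have small: "v $ site k = 0" if "k < 2 * ?K" for k
    proof (cases "Parity.even k")
      case True
      then show ?thesis using even[of "k div 2"] that by auto
    next
      case False
      then show ?thesis using odd[of "k div 2"] that by auto
    qed
    have "v $ site k = 0" if k: "k < CARD('n)" for k
    proof (cases "k < 2 * ?K")
      case False
      then have k2: "k = 2 * ?K" and n: "CARD('n) = Suc k" using k by presburger+
      have "(\<Sum>j\<in>UNIV. alt_vec $ j * v $ j) = 0"
        using row[of "site k"] k k2 by (simp add: L_def)
      then have "alt_vec $ (site k :: 'n) * v $ site k = 0"
        unfolding sum_site n using small k2 by simp
      then show ?thesis using k by (simp add: alt_vec_def)
    qed (rule small)
    then show "v = 0" using ex_site by (metis vec_eq_iff zero_index)
  qed
  then have "det L \<noteq> 0"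
    unfolding invertible_det_nz[symmetric] invertible_left_inverse matrix_left_invertible_ker by blast
  then have "eventually (\<lambda>t. det (peak_jacobian m (peak_curve m t)) \<noteq> 0) at_top"
    using lim by (intro tendsto_imp_eventually_ne)
  then show ?thesis using eventually_happens'[OF trivial_limit_at_top_linorder] by blast
qed

text \<open>The Jacobian determinant is an exponential sum that is nonzero at some point of the
  whole space, so it is nonzero somewhere in every ball about a point of the open domain,
  intersected with that domain.\<close>

lemma peak_integral_indep_dense:
  fixes m :: "'n::{finite,linorder} \<Rightarrow> real"
  assumes m: "\<forall>i. m i > 0"
  shows "peakon_domain \<subseteq>
    closure {x \<in> peakon_domain. indep_at (CARD('n) - CARD('n) div 2) (peak_integral m) x}"
proof
  fix x :: "(real, 'n) vec" assume x: "x \<in> peakon_domain"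
  obtain x0 where x0: "det (peak_jacobian m x0) \<noteq> 0"
    using peak_jacobian_nonsingular_somewhere[OF m] by blast
  show "x \<in> closure {x \<in> peakon_domain. indep_at (CARD('n) - CARD('n) div 2) (peak_integral m) x}"
    unfolding closure_approachable
  proof (intro allI impI)
    fix e :: real assume "e > 0"
    have "\<exists>y\<in>peakon_domain \<inter> ball x e. det (peak_jacobian m y) \<noteq> 0"
    proof (rule expsum_nonzero_dense[where f = "\<lambda>x. det (peak_jacobian m x)", OF _ x0])
      show "expsum (\<lambda>x. det (peak_jacobian m x))"
        by (rule expsum_det) (rule expsum_peak_jacobian)
      show "open (peakon_domain \<inter> ball x e)" using open_peakon_domain by auto
    qed (use x \<open>e > 0\<close> in auto)
    then show "\<exists>y\<in>{x \<in> peakon_domain. indep_at (CARD('n) - CARD('n) div 2) (peak_integral m) x}. dist y x < e"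
      using indep_at_peak_integral[of m] by (auto simp: dist_commute)
  qed
qed

theorem theorem6:
  fixes m :: "'n::{finite,linorder} \<Rightarrow> real"
  assumes "\<forall>i. m i > 0"
  shows "(\<forall>x\<in>peakon_domain. peakon_field m x = ham_field peakon_poisson (peakon_ham m) x)
       \<and> liouville_integrable peakon_domain peakon_poisson (peakon_ham m)"
proof
  \<comment> \<open>Half the rank is \<open>n div 2\<close>, so this is the required number of
    integrals: one per pair, and the Casimir for odd \<open>n\<close>.\<close>
  let ?s = "CARD('n) - CARD('n) div 2"
  show "\<forall>x\<in>peakon_domain. peakon_field m x = ham_field peakon_poisson (peakon_ham m) x"
    using peakon_field_eq_ham_field by blast
  have "poisson_rank peakon_domain (peakon_poisson :: (real, 'n) vec \<Rightarrow> _) div 2 + ?s = CARD('n)"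
    by (simp add: poisson_rank_peakon)
  then show "liouville_integrable peakon_domain peakon_poisson (peakon_ham m)"
    unfolding liouville_integrable_def
    using expsum_smooth_on[OF expsum_peak_integral] pbracket_peak_integral
      pbracket_peak_integral_ham peak_integral_indep_dense[OF assms]
    by (intro exI[of _ ?s] exI[of _ "peak_integral m"]) blast
qed

end
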